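(* Let $G=(V,A)$ be a network with $V=V'\cup\{s,t\}$, let $\bar V\subseteq V'$ be the set of nodes subject to the no-split no-merge requirement, and for each $q\in\bar V$ let $\operatorname{ind}^-(\cdot,q)$ and $\operatorname{ind}^+(q,\cdot)$ be the index bijections of the incoming and outgoing arcs of $q$. Consider the constraint system in the variables $\boldsymbol w=(w^q_h)_{q\in\bar V,\,1\le h\le|\delta^-(q)|}$ $$\sum_{i\in\delta^-(q)}\operatorname{sign}\left(\left|w^q_{\operatorname{ind}^-(i,q)}-\operatorname{ind}^+(q,j)\right|\right)\ \ge\ |\delta^-(q)|-1\qquad\forall j\in\delta^+(q),\ \forall q\in\bar V,$$ $$w^q_{\operatorname{ind}^-(i,q)}\in\{0,1,\dots,|\delta^+(q)|\}\qquad\forall i\in\delta^-(q),\ \forall q\in\bar V.$$ This system models the matching between incoming and outgoing arcs of the nodes $q\in\bar V$. That is: (1) for every family $(M^q)_{q\in\bar V}$, where $M^q$ is a matching between the incoming and outgoing arcs of $q$, the vector $\boldsymbol w$ associated with the family satisfies the system; and (2) for every $\boldsymbol w$ satisfying the system and every $q\in\bar V$, the set of pairs encoded by $\boldsymbol w$ at $q$, namely $\{(i,j)\in\delta^-(q)\times\delta^+(q): w^q_{\operatorname{ind}^-(i,q)}=\operatorname{ind}^+(q,j)\}$, is a matching between the incoming and outgoing arcs of $q$.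
   Context: $G=(V,A)$ is a finite directed graph with $A\subseteq V\times V$, source $s$ and sink $t$. For $q\in V$, $\delta^-(q)=\{i\in V:(i,q)\in A\}$ and $\delta^+(q)=\{j\in V:(q,j)\in A\}$ are the sets of incoming and outgoing neighbors of $q$. For $q\in\bar V$, $\operatorname{ind}^-(i,q)$ ($i\in\delta^-(q)$) is a one-to-one mapping from the incoming arcs $(i,q)$ onto $\{1,\dots,|\delta^-(q)|\}$, and $\operatorname{ind}^+(q,j)$ ($j\in\delta^+(q)$) is a one-to-one mapping from the outgoing arcs $(q,j)$ onto $\{1,\dots,|\delta^+(q)|\}$. The function $\operatorname{sign}$ returns $1$ for a strictly positive argument, $0$ for zero, and $-1$ otherwise; $|\cdot|$ is cardinality for sets and absolute value for real numbers. A matching between incoming and outgoing arcs of $q$ is a set $M^q\subseteq\delta^-(q)\times\delta^+(q)$ such that each $i\in\delta^-(q)$ appears in at most one pair of $M^q$ and each $j\in\delta^+(q)$ appears in at most one pair of $M^q$; $(i,j)\in M^q$ means that incoming arc $(i,q)$ is matched with outgoing arc $(q,j)$. The vector $\boldsymbol w$ associated with a family $(M^q)_{q\in\bar V}$ has $w^q_{\operatorname{ind}^-(i,q)}=\operatorname{ind}^+(q,j)$ if $(i,j)\in M^q$, and $w^q_{\operatorname{ind}^-(i,q)}=0$ if $i$ appears in no pair of $M^q$. *)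

theory Defs
  imports Complex_Main "Graph_Theory.Pair_Digraph"
begin

definition in_nbrs :: "'v pair_pre_digraph \<Rightarrow> 'v \<Rightarrow> 'v set" where
  "in_nbrs G q = {i \<in> pverts G. (i, q) \<in> parcs G}"

definition out_nbrs :: "'v pair_pre_digraph \<Rightarrow> 'v \<Rightarrow> 'v set" where
  "out_nbrs G q = {j \<in> pverts G. (q, j) \<in> parcs G}"

definition index_maps ::
  "'v pair_pre_digraph \<Rightarrow> 'v set \<Rightarrow> ('v \<Rightarrow> 'v \<Rightarrow> nat) \<Rightarrow> ('v \<Rightarrow> 'v \<Rightarrow> nat) \<Rightarrow> bool" where
  "index_maps G Vbar ind_in ind_out \<longleftrightarrow>
     (\<forall>q\<in>Vbar. bij_betw (\<lambda>i. ind_in i q) (in_nbrs G q) {1..card (in_nbrs G q)} \<and>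
               bij_betw (\<lambda>j. ind_out q j) (out_nbrs G q) {1..card (out_nbrs G q)})"

definition arc_matching :: "'v pair_pre_digraph \<Rightarrow> 'v \<Rightarrow> ('v \<times> 'v) set \<Rightarrow> bool" where
  "arc_matching G q M \<longleftrightarrow>
     M \<subseteq> in_nbrs G q \<times> out_nbrs G q \<and>
     (\<forall>i\<in>in_nbrs G q. \<exists>\<^sub>\<le>\<^sub>1 p. p \<in> M \<and> fst p = i) \<and>
     (\<forall>j\<in>out_nbrs G q. \<exists>\<^sub>\<le>\<^sub>1 p. p \<in> M \<and> snd p = j)"

text \<open>
  A vector is a total function of a node \<open>q\<close> and a position \<open>h\<close>; only its values at
  \<open>q \<in> Vbar\<close> and \<open>1 \<le> h \<le> |in_nbrs G q|\<close> are variables of the system.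
\<close>

definition matching_vector ::
  "'v pair_pre_digraph \<Rightarrow> ('v \<Rightarrow> 'v \<Rightarrow> nat) \<Rightarrow> ('v \<Rightarrow> 'v \<Rightarrow> nat) \<Rightarrow>
   ('v \<Rightarrow> ('v \<times> 'v) set) \<Rightarrow> 'v \<Rightarrow> nat \<Rightarrow> real" where
  "matching_vector G ind_in ind_out M q h =
     (let i = the_inv_into (in_nbrs G q) (\<lambda>i. ind_in i q) h
      in if \<exists>j. (i, j) \<in> M q then real (ind_out q (THE j. (i, j) \<in> M q)) else 0)"

lemma matching_vector_matched:
  assumes "index_maps G Vbar ind_in ind_out" "q \<in> Vbar" "arc_matching G q (M q)"
    and "(i, j) \<in> M q"
  shows "matching_vector G ind_in ind_out M q (ind_in i q) = real (ind_out q j)"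
proof -
  have i: "i \<in> in_nbrs G q" using assms(3,4) by (auto simp: arc_matching_def)
  have inv: "the_inv_into (in_nbrs G q) (\<lambda>i. ind_in i q) (ind_in i q) = i"
    using assms(1,2) i
    by (intro the_inv_into_f_f[where f = "\<lambda>i. ind_in i q"])
       (auto simp: index_maps_def bij_betw_def)
  have "(THE j. (i, j) \<in> M q) = j"
  proof (rule the_equality)
    show "(i, j) \<in> M q" by fact
    fix j' assume "(i, j') \<in> M q"
    moreover have "\<exists>\<^sub>\<le>\<^sub>1 p. p \<in> M q \<and> fst p = i"
      using assms(3) i by (auto simp: arc_matching_def)
    ultimately show "j' = j" using assms(4) unfolding Uniq_def by force
  qed
  then show ?thesis using assms(4) inv by (auto simp: matching_vector_def)
qed

lemma matching_vector_unmatched: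
  assumes "index_maps G Vbar ind_in ind_out" "q \<in> Vbar"
    and "i \<in> in_nbrs G q" "\<nexists>j. (i, j) \<in> M q"
  shows "matching_vector G ind_in ind_out M q (ind_in i q) = 0"
proof -
  have "the_inv_into (in_nbrs G q) (\<lambda>i. ind_in i q) (ind_in i q) = i"
    using assms(1-3)
    by (intro the_inv_into_f_f[where f = "\<lambda>i. ind_in i q"])
       (auto simp: index_maps_def bij_betw_def)
  then show ?thesis using assms(4) by (simp add: matching_vector_def)
qed

definition satisfies_system ::
  "'v pair_pre_digraph \<Rightarrow> 'v set \<Rightarrow> ('v \<Rightarrow> 'v \<Rightarrow> nat) \<Rightarrow> ('v \<Rightarrow> 'v \<Rightarrow> nat) \<Rightarrow>
   ('v \<Rightarrow> nat \<Rightarrow> real) \<Rightarrow> bool" where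
  "satisfies_system G Vbar ind_in ind_out w \<longleftrightarrow>
     (\<forall>q\<in>Vbar. \<forall>j\<in>out_nbrs G q.
        (\<Sum>i\<in>in_nbrs G q. sgn \<bar>w q (ind_in i q) - real (ind_out q j)\<bar>)
          \<ge> real (card (in_nbrs G q)) - 1) \<and>
     (\<forall>q\<in>Vbar. \<forall>i\<in>in_nbrs G q.
        w q (ind_in i q) \<in> real ` {0..card (out_nbrs G q)})"

definition encoded_pairs ::
  "'v pair_pre_digraph \<Rightarrow> ('v \<Rightarrow> 'v \<Rightarrow> nat) \<Rightarrow> ('v \<Rightarrow> 'v \<Rightarrow> nat) \<Rightarrow>
   ('v \<Rightarrow> nat \<Rightarrow> real) \<Rightarrow> 'v \<Rightarrow> ('v \<times> 'v) set" where
  "encoded_pairs G ind_in ind_out w q =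
     {(i, j) \<in> in_nbrs G q \<times> out_nbrs G q. w q (ind_in i q) = real (ind_out q j)}"

end

theory Submission
  imports Defs
begin

text \<open>
  Each summand of the constraint for the outgoing arc \<open>(q, j)\<close> is 0 if the vector sends the
  incoming arc to the index of \<open>j\<close>, and 1 otherwise. Hence the constraint says exactly that at
  most one incoming arc is sent to \<open>j\<close>. That an incoming arc is matched at most once comes for
  free, as the vector assigns it a single value and the indices of the outgoing arcs are distinct.
\<close>

lemma sum_sgn_abs_diff_ge_iff_Uniq:
  fixes x :: "'a \<Rightarrow> real"
  assumes "finite I"
  shows "(\<Sum>i\<in>I. sgn \<bar>x i - c\<bar>) \<ge> real (card I) - 1 \<longleftrightarrow> (\<exists>\<^sub>\<le>\<^sub>1 i. i \<in> I \<and> x i = c)"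
proof -
  let ?E = "{i \<in> I. x i = c}"
  \<comment> \<open>The absolute value excludes the value -1 of \<open>sgn\<close>, so each summand
    is the indicator of \<open>x i \<noteq> c\<close>.\<close>
  have "(\<Sum>i\<in>I. sgn \<bar>x i - c\<bar>) = (\<Sum>i\<in>I. 1 - (if x i = c then 1 else 0))"
    by (intro sum.cong) (auto simp: sgn_if)
  also have "\<dots> = real (card I) - real (card ?E)"
    using assms by (simp add: sum_subtractf sum.If_cases Int_def)
  finally have "(\<Sum>i\<in>I. sgn \<bar>x i - c\<bar>) \<ge> real (card I) - 1 \<longleftrightarrow> card ?E \<le> Suc 0"
    by simp
  also have "\<dots> \<longleftrightarrow> (\<exists>\<^sub>\<le>\<^sub>1 i. i \<in> I \<and> x i = c)"
    using assms by (subst card_le_Suc0_iff_eq) (auto simp: Uniq_def)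
  finally show ?thesis .
qed

text \<open>Both directions of the theorem work with this sum-free form. Finiteness is assumed at
  every node so that the sums can be rewritten under the quantifier over \<open>q\<close>.\<close>

lemma satisfies_system_iff:
  assumes "\<And>q. finite (in_nbrs G q)"
  shows "satisfies_system G Vbar ind_in ind_out w \<longleftrightarrow>
     (\<forall>q\<in>Vbar. \<forall>j\<in>out_nbrs G q.
        \<exists>\<^sub>\<le>\<^sub>1 i. i \<in> in_nbrs G q \<and> w q (ind_in i q) = real (ind_out q j)) \<and>
     (\<forall>q\<in>Vbar. \<forall>i\<in>in_nbrs G q. w q (ind_in i q) \<in> real ` {0..card (out_nbrs G q)})"
  unfolding satisfies_system_def sum_sgn_abs_diff_ge_iff_Uniq[OF assms] ..

lemma index_maps_out_eq_iff:
  assumes "index_maps G Vbar ind_in ind_out" "q \<in> Vbar" "j \<in> out_nbrs G q" "j' \<in> out_nbrs G q"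
  shows "ind_out q j = ind_out q j' \<longleftrightarrow> j = j'"
  using assms by (auto simp: index_maps_def bij_betw_def dest: inj_onD)

lemma index_maps_out_range:
  assumes "index_maps G Vbar ind_in ind_out" "q \<in> Vbar" "j \<in> out_nbrs G q"
  shows "ind_out q j \<in> {1..card (out_nbrs G q)}"
  using assms bij_betw_apply[of "\<lambda>j. ind_out q j"] unfolding index_maps_def by blast

text \<open>Injectivity of \<open>ind_out q\<close> recovers the partner of a matched arc from its
  index. This lets the constraints on \<open>matching_vector\<close> be checked inside
  \<open>M q\<close> itself.\<close>

lemma encoded_pairs_matching_vector:
  assumes "index_maps G Vbar ind_in ind_out" "q \<in> Vbar" "arc_matching G q (M q)"
  shows "encoded_pairs G ind_in ind_out (matching_vector G ind_in ind_out M) q = M q"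
proof (intro set_eqI iffI; clarify)
  let ?w = "matching_vector G ind_in ind_out M"
  fix i j
  show "(i, j) \<in> M q" if "(i, j) \<in> encoded_pairs G ind_in ind_out ?w q"
  proof -
    from that have i: "i \<in> in_nbrs G q" and j: "j \<in> out_nbrs G q"
      and w: "?w q (ind_in i q) = real (ind_out q j)"
      by (auto simp: encoded_pairs_def)
    \<comment> \<open>The indices of outgoing arcs start at 1, so 0 unambiguously means unmatched.\<close>
    have "?w q (ind_in i q) \<noteq> 0"
      using w index_maps_out_range[OF assms(1,2) j] by simp
    then obtain j' where j': "(i, j') \<in> M q"
      using matching_vector_unmatched[OF assms(1,2) i] by blast
    then have "j' \<in> out_nbrs G q"
      using assms(3) by (auto simp: arc_matching_def)
    moreover have "ind_out q j' = ind_out q j"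
      using w matching_vector_matched[of G Vbar ind_in ind_out q M, OF assms j'] by simp
    ultimately have "j' = j"
      using index_maps_out_eq_iff[OF assms(1,2)] j by blast
    with j' show ?thesis by simp
  qed
  show "(i, j) \<in> encoded_pairs G ind_in ind_out ?w q" if "(i, j) \<in> M q"
    using that matching_vector_matched[of G Vbar ind_in ind_out q M, OF assms that] assms(3)
    by (auto simp: encoded_pairs_def arc_matching_def)
qed

text \<open>Incoming arcs whose value is the index of \<open>j\<close> are all paired with
  \<open>j\<close> in \<open>M q\<close>, since decoding gives back \<open>M q\<close>; a matching
  has at most one such pair.\<close>

lemma satisfies_system_matching_vector:
  assumes "\<And>q. finite (in_nbrs G q)" "index_maps G Vbar ind_in ind_out"
    and M: "\<And>q. q \<in> Vbar \<Longrightarrow> arc_matching G q (M q)"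
  shows "satisfies_system G Vbar ind_in ind_out (matching_vector G ind_in ind_out M)"
  unfolding satisfies_system_iff[OF assms(1)]
proof (intro conjI ballI)
  let ?w = "matching_vector G ind_in ind_out M"
  fix q assume q: "q \<in> Vbar"
  show "\<exists>\<^sub>\<le>\<^sub>1 i. i \<in> in_nbrs G q \<and> ?w q (ind_in i q) = real (ind_out q j)"
    if j: "j \<in> out_nbrs G q" for j
  proof (rule Uniq_I)
    have mem: "(i, j) \<in> M q"
      if "i \<in> in_nbrs G q \<and> ?w q (ind_in i q) = real (ind_out q j)" for i
      using that j encoded_pairs_matching_vector[of G Vbar ind_in ind_out q M, OF assms(2) q M[OF q]]
      by (auto simp: encoded_pairs_def)
    have uniq: "\<exists>\<^sub>\<le>\<^sub>1 p. p \<in> M q \<and> snd p = j"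
      using M[OF q] j by (simp add: arc_matching_def)
    fix i i'
    assume "i \<in> in_nbrs G q \<and> ?w q (ind_in i q) = real (ind_out q j)"
      and "i' \<in> in_nbrs G q \<and> ?w q (ind_in i' q) = real (ind_out q j)"
    then have "(i, j) \<in> M q" "(i', j) \<in> M q"
      by (blast intro: mem)+
    with uniq show "i' = i" by (force simp: Uniq_def)
  qed
  show "?w q (ind_in i q) \<in> real ` {0..card (out_nbrs G q)}" if i: "i \<in> in_nbrs G q" for i
  proof (cases "\<exists>j. (i, j) \<in> M q")
    case True
    then obtain j where j: "(i, j) \<in> M q" by blast
    then have "j \<in> out_nbrs G q" using M[OF q] by (auto simp: arc_matching_def)
    then have "ind_out q j \<in> {0..card (out_nbrs G q)}"
      using index_maps_out_range[OF assms(2) q] by auto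
    then show ?thesis
      using matching_vector_matched[of G Vbar ind_in ind_out q M, OF assms(2) q M[OF q] j] by simp
  next
    case False
    \<comment> \<open>The value is 0, which the range includes to allow for unmatched arcs.\<close>
    then show ?thesis
      using matching_vector_unmatched[OF assms(2) q i, of M] by force
  qed
qed

lemma arc_matching_encoded_pairs:
  assumes "\<And>q. finite (in_nbrs G q)" "index_maps G Vbar ind_in ind_out"
    and "satisfies_system G Vbar ind_in ind_out w" "q \<in> Vbar"
  shows "arc_matching G q (encoded_pairs G ind_in ind_out w q)"
  unfolding arc_matching_def
proof (intro conjI ballI)
  let ?E = "encoded_pairs G ind_in ind_out w q"
  show "?E \<subseteq> in_nbrs G q \<times> out_nbrs G q"
    by (auto simp: encoded_pairs_def)
  \<comment> \<open>Two partners of \<open>i\<close> have the same index, namely the single value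
    \<open>w q (ind_in i q)\<close>, so they coincide.\<close>
  show "\<exists>\<^sub>\<le>\<^sub>1 p. p \<in> ?E \<and> fst p = i" for i
    using index_maps_out_eq_iff[OF assms(2,4)] by (auto simp: Uniq_def encoded_pairs_def)
  show "\<exists>\<^sub>\<le>\<^sub>1 p. p \<in> ?E \<and> snd p = j" if "j \<in> out_nbrs G q" for j
  proof -
    have "\<exists>\<^sub>\<le>\<^sub>1 i. i \<in> in_nbrs G q \<and> w q (ind_in i q) = real (ind_out q j)"
      using assms(3,4) that by (simp add: satisfies_system_iff[OF assms(1)])
    \<comment> \<open>With \<open>j\<close> fixed, a pair is determined by its first component, so
      uniqueness passes from \<open>i\<close> to the pair.\<close>
    then show ?thesis by (auto simp: Uniq_def encoded_pairs_def)
  qed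
qed

theorem proposition2:
  fixes G :: "'v pair_pre_digraph"
    and V' Vbar :: "'v set"
    and s t :: 'v
    and ind_in ind_out :: "'v \<Rightarrow> 'v \<Rightarrow> nat"
  assumes "pair_fin_digraph G"
    and "pverts G = V' \<union> {s, t}"
    and "Vbar \<subseteq> V'"
    and "index_maps G Vbar ind_in ind_out"
  shows "(\<forall>M. (\<forall>q\<in>Vbar. arc_matching G q (M q)) \<longrightarrow>
            satisfies_system G Vbar ind_in ind_out (matching_vector G ind_in ind_out M)) \<and>
         (\<forall>w. satisfies_system G Vbar ind_in ind_out w \<longrightarrow>
            (\<forall>q\<in>Vbar. arc_matching G q (encoded_pairs G ind_in ind_out w q)))"
proof -
  interpret pair_fin_digraph G by fact
  \<comment> \<open>The neighbors lie in the finite vertex set; both directions rely on this to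
    evaluate the sums.\<close>
  have "finite (in_nbrs G q)" for q
    by (simp add: in_nbrs_def)
  then show ?thesis
    using satisfies_system_matching_vector[OF _ assms(4)] arc_matching_encoded_pairs[OF _ assms(4)]
    by blast
qed

end
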